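(* Let $(A,\mu,[-,-],\varepsilon)$ be a color NLP-algebra and $\alpha_A:A\to A$ an even endomorphism. For an integer $n\ge1$ and $x,y\in\mathcal H(A)$ put $$\mu_{\alpha_A^n}(x,y):=\alpha_A^n(\mu(x,y)),\qquad [x,y]_{\alpha_A^n}:=\alpha_A^n([x,y]).$$ Then, for any integer $n\ge 1$, $(A,\mu_{\alpha_A^n},[-,-]_{\alpha_A^n},\varepsilon,\alpha_A^n)$ is a multiplicative color NHLP-algebra. Moreover, suppose that $(\tilde A,\tilde\mu,\{-,-\},\varepsilon)$ is another color NLP-algebra and $\alpha_{\tilde A}$ is an even endomorphism of $\tilde A$. If $f:A\to\tilde A$ is a morphism of color NLP-algebras such that $f\circ\alpha_A=\alpha_{\tilde A}\circ f$, then $$f:(A,\mu_{\alpha_A^n},[-,-]_{\alpha_A^n},\varepsilon,\alpha_A^n)\to(\tilde A,\tilde\mu_{\alpha_{\tilde A}^n},\{-,-\}_{\alpha_{\tilde A}^n},\varepsilon,\alpha_{\tilde A}^n)$$ is a morphism of multiplicative color NHLP-algebras for any integer $n\ge1$.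
   Context: $\mathbf K$ is a field of characteristic $0$ and $G$ is an abelian group (written additively). For a $G$-graded vector space $V$, $\mathcal H(V)$ is the set of homogeneous elements. A linear (or bilinear) map is even if it preserves degrees. A bicharacter is a map $\varepsilon:G\times G\to\mathbf K^*$ with $\varepsilon(a,b)\varepsilon(b,a)=1$, $\varepsilon(a,b+c)=\varepsilon(a,b)\varepsilon(a,c)$, $\varepsilon(a+b,c)=\varepsilon(a,c)\varepsilon(b,c)$. For homogeneous $x,y$ of degrees $a,b$ one writes $\varepsilon(x,y):=\varepsilon(a,b)$. A color NHLP-algebra (non-commutative Hom-Leibniz-Poisson algebra) $(P,\mu,[-,-],\varepsilon,\alpha_P)$ is a $G$-graded vector space $P$ with even bilinear maps $[-,-],\mu:P\otimes P\to P$, a bicharacter $\varepsilon$ and an even linear map $\alpha_P:P\to P$ such that for all homogeneous $x,y,z\in P$: (i) $[\alpha_P(x),[y,z]]=[[x,y],\alpha_P(z)]+\varepsilon(x,y)[\alpha_P(y),[x,z]]$; (ii) $\mu(\alpha_P(x),\mu(y,z))=\mu(\mu(x,y),\alpha_P(z))$; (iii) $[\alpha_P(x),\mu(y,z)]=\mu([x,y],\alpha_P(z))+\varepsilon(x,y)\mu(\alpha_P(y),[x,z])$. It is multiplicative if $\alpha_P$ is an endomorphism with respect to $\mu$ and $[-,-]$. A color NLP-algebra (non-commutative Leibniz-Poisson algebra) is the case $\alpha_P=\mathrm{Id}_P$. A morphism of color NLP-algebras is an even linear map preserving both operations (an even endomorphism is such a morphism from the algebra to itself); a morphism of color NHLP-algebras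 is an even linear map preserving both operations and commuting with the twisting maps. *)

theory Defs
  imports Complex_Main
begin

locale graded_vector_space = vector_space scale
  for scale :: "'k::field_char_0 \<Rightarrow> 'v::ab_group_add \<Rightarrow> 'v" +
  fixes gr :: "'g::ab_group_add \<Rightarrow> 'v set"
  assumes subspace_gr: "subspace (gr a)"
    and direct_sum:
      "\<exists>!c. (\<forall>a. c a \<in> gr a) \<and> finite {a. c a \<noteq> 0} \<and> v = (\<Sum>a | c a \<noteq> 0. c a)"

definition even_linear ::
  "('k::field_char_0 \<Rightarrow> 'v::ab_group_add \<Rightarrow> 'v) \<Rightarrow> ('g::ab_group_add \<Rightarrow> 'v set) \<Rightarrow>
   ('k \<Rightarrow> 'w::ab_group_add \<Rightarrow> 'w) \<Rightarrow> ('g \<Rightarrow> 'w set) \<Rightarrow> ('v \<Rightarrow> 'w) \<Rightarrow> bool"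
  where "even_linear s V t W f \<longleftrightarrow>
    Vector_Spaces.linear s t f \<and> (\<forall>a. \<forall>x\<in>V a. f x \<in> W a)"

definition even_bilinear ::
  "('k::field_char_0 \<Rightarrow> 'v::ab_group_add \<Rightarrow> 'v) \<Rightarrow> ('g::ab_group_add \<Rightarrow> 'v set) \<Rightarrow>
   ('v \<Rightarrow> 'v \<Rightarrow> 'v) \<Rightarrow> bool"
  where "even_bilinear s V m \<longleftrightarrow>
    (\<forall>x. Vector_Spaces.linear s s (\<lambda>y. m x y)) \<and>
    (\<forall>y. Vector_Spaces.linear s s (\<lambda>x. m x y)) \<and>
    (\<forall>a b. \<forall>x\<in>V a. \<forall>y\<in>V b. m x y \<in> V (a + b))"

definition bicharacter :: "('g::ab_group_add \<Rightarrow> 'g \<Rightarrow> 'k::field_char_0) \<Rightarrow> bool"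
  where "bicharacter \<epsilon> \<longleftrightarrow>
    (\<forall>a b. \<epsilon> a b \<noteq> 0) \<and>
    (\<forall>a b. \<epsilon> a b * \<epsilon> b a = 1) \<and>
    (\<forall>a b c. \<epsilon> a (b + c) = \<epsilon> a b * \<epsilon> a c) \<and>
    (\<forall>a b c. \<epsilon> (a + b) c = \<epsilon> a c * \<epsilon> b c)"

text \<open>
  The identities range over degrees and elements of the corresponding components, so that
  \<open>\<epsilon>(x, y)\<close> is \<open>\<epsilon> a b\<close> for \<open>x\<close> of degree \<open>a\<close> and \<open>y\<close> of degree \<open>b\<close>. The zero vector, which lies
  in every component, satisfies the identities whatever degree it is given.
\<close>

locale color_NHLP_algebra = graded_vector_space scale gr
  for scale :: "'k::field_char_0 \<Rightarrow> 'v::ab_group_add \<Rightarrow> 'v"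
    and gr :: "'g::ab_group_add \<Rightarrow> 'v set" +
  fixes \<mu> :: "'v \<Rightarrow> 'v \<Rightarrow> 'v"
    and br :: "'v \<Rightarrow> 'v \<Rightarrow> 'v"
    and \<epsilon> :: "'g \<Rightarrow> 'g \<Rightarrow> 'k"
    and \<alpha> :: "'v \<Rightarrow> 'v"
  assumes even_mu: "even_bilinear scale gr \<mu>"
    and even_br: "even_bilinear scale gr br"
    and bichar: "bicharacter \<epsilon>"
    and even_alpha: "even_linear scale gr scale gr \<alpha>"
    and hom_leibniz: "\<lbrakk>x \<in> gr a; y \<in> gr b; z \<in> gr c\<rbrakk> \<Longrightarrow>
      br (\<alpha> x) (br y z) = br (br x y) (\<alpha> z) + scale (\<epsilon> a b) (br (\<alpha> y) (br x z))"
    and hom_assoc: "\<lbrakk>x \<in> gr a; y \<in> gr b; z \<in> gr c\<rbrakk> \<Longrightarrow>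
      \<mu> (\<alpha> x) (\<mu> y z) = \<mu> (\<mu> x y) (\<alpha> z)"
    and hom_poisson: "\<lbrakk>x \<in> gr a; y \<in> gr b; z \<in> gr c\<rbrakk> \<Longrightarrow>
      br (\<alpha> x) (\<mu> y z) = \<mu> (br x y) (\<alpha> z) + scale (\<epsilon> a b) (\<mu> (\<alpha> y) (br x z))"

locale multiplicative_color_NHLP_algebra = color_NHLP_algebra +
  assumes alpha_mu: "\<alpha> (\<mu> x y) = \<mu> (\<alpha> x) (\<alpha> y)"
    and alpha_br: "\<alpha> (br x y) = br (\<alpha> x) (\<alpha> y)"

locale color_NLP_algebra = color_NHLP_algebra scale gr \<mu> br \<epsilon> id
  for scale :: "'k::field_char_0 \<Rightarrow> 'v::ab_group_add \<Rightarrow> 'v"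
    and gr :: "'g::ab_group_add \<Rightarrow> 'v set" and \<mu> br \<epsilon>

locale color_NLP_morphism =
  A: color_NLP_algebra scaleA grA \<mu>A brA \<epsilon> + B: color_NLP_algebra scaleB grB \<mu>B brB \<epsilon>
  for scaleA :: "'k::field_char_0 \<Rightarrow> 'v::ab_group_add \<Rightarrow> 'v"
    and grA :: "'g::ab_group_add \<Rightarrow> 'v set" and \<mu>A brA
    and scaleB :: "'k \<Rightarrow> 'w::ab_group_add \<Rightarrow> 'w"
    and grB :: "'g \<Rightarrow> 'w set" and \<mu>B brB and \<epsilon> +
  fixes f :: "'v \<Rightarrow> 'w"
  assumes even_f: "even_linear scaleA grA scaleB grB f"
    and f_mu: "f (\<mu>A x y) = \<mu>B (f x) (f y)"
    and f_br: "f (brA x y) = brB (f x) (f y)"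

locale multiplicative_color_NHLP_morphism =
  A: multiplicative_color_NHLP_algebra scaleA grA \<mu>A brA \<epsilon> \<alpha>A +
  B: multiplicative_color_NHLP_algebra scaleB grB \<mu>B brB \<epsilon> \<alpha>B
  for scaleA :: "'k::field_char_0 \<Rightarrow> 'v::ab_group_add \<Rightarrow> 'v"
    and grA :: "'g::ab_group_add \<Rightarrow> 'v set" and \<mu>A brA \<alpha>A
    and scaleB :: "'k \<Rightarrow> 'w::ab_group_add \<Rightarrow> 'w"
    and grB :: "'g \<Rightarrow> 'w set" and \<mu>B brB \<alpha>B and \<epsilon> +
  fixes f :: "'v \<Rightarrow> 'w"
  assumes even_f: "even_linear scaleA grA scaleB grB f"
    and f_mu: "f (\<mu>A x y) = \<mu>B (f x) (f y)"
    and f_br: "f (brA x y) = brB (f x) (f y)"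
    and f_alpha: "f \<circ> \<alpha>A = \<alpha>B \<circ> f"

abbreviation color_NLP_endomorphism ::
  "('k::field_char_0 \<Rightarrow> 'v::ab_group_add \<Rightarrow> 'v) \<Rightarrow> ('g::ab_group_add \<Rightarrow> 'v set) \<Rightarrow>
   ('v \<Rightarrow> 'v \<Rightarrow> 'v) \<Rightarrow> ('v \<Rightarrow> 'v \<Rightarrow> 'v) \<Rightarrow> ('g \<Rightarrow> 'g \<Rightarrow> 'k) \<Rightarrow> ('v \<Rightarrow> 'v) \<Rightarrow> bool"
  where "color_NLP_endomorphism s V m b \<epsilon> \<alpha> \<equiv> color_NLP_morphism s V m b s V m b \<epsilon> \<alpha>"

text \<open>The bilinear extension of the operation given on homogeneous elements by \<open>\<alpha>\<^sup>n(m(x, y))\<close>.\<close>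

definition twist :: "('v \<Rightarrow> 'v) \<Rightarrow> nat \<Rightarrow> ('v \<Rightarrow> 'v \<Rightarrow> 'v) \<Rightarrow> 'v \<Rightarrow> 'v \<Rightarrow> 'v"
  where "twist \<alpha> n m x y = (\<alpha> ^^ n) (m x y)"

end

theory Submission imports Defs begin

lemma even_linear_id:
  assumes "vector_space s"
  shows "even_linear s V s V id"
  using vector_space.linear_id[OF assms] by (simp add: even_linear_def)

lemma even_linear_compose:
  assumes "even_linear s U t V f" and "even_linear t V u W g"
  shows "even_linear s U u W (g \<circ> f)"
  using assms by (auto simp: even_linear_def intro: Vector_Spaces.linear_compose)

text \<open>A degree-preserving map leaves the degree a + b of a product unchanged, so twisting an
  even operation keeps it even.\<close>

lemma even_bilinear_compose:
  assumes "even_bilinear s V m" and "even_linear s V s V f"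
  shows "even_bilinear s V (\<lambda>x y. f (m x y))"
  using assms Vector_Spaces.linear_compose[of s s _ s f]
  by (simp add: even_bilinear_def even_linear_def o_def)

text \<open>This removes the exponent from the algebra part: \<open>\<alpha> ^^ n\<close> is itself
  an even endomorphism \<beta>, so it is enough to twist once by an arbitrary \<beta>, and the
  identities are never proved by induction on n.\<close>

lemma color_NLP_endomorphism_funpow:
  assumes "color_NLP_endomorphism s V m b \<epsilon> \<alpha>"
  shows "color_NLP_endomorphism s V m b \<epsilon> (\<alpha> ^^ n)"
proof -
  interpret \<alpha>: color_NLP_morphism s V m b s V m b \<epsilon> \<alpha> by (rule assms)
  show ?thesis
  proof
    show "even_linear s V s V (\<alpha> ^^ n)"
    proof (induction n)
      case 0
      show ?case using even_linear_id[OF \<alpha>.A.vector_space_axioms] by (simp add: id_def)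
    next
      case (Suc n)
      then show ?case using even_linear_compose[OF _ \<alpha>.even_f] by (simp add: o_def)
    qed
    show "(\<alpha> ^^ n) (m x y) = m ((\<alpha> ^^ n) x) ((\<alpha> ^^ n) y)" for x y
      by (induction n) (simp_all add: \<alpha>.f_mu)
    show "(\<alpha> ^^ n) (b x y) = b ((\<alpha> ^^ n) x) ((\<alpha> ^^ n) y)" for x y
      by (induction n) (simp_all add: \<alpha>.f_br)
  qed
qed

text \<open>
  Since \<open>\<beta>\<close> commutes with both operations, each identity of the twisted algebra is \<open>\<beta> \<circ> \<beta>\<close>
  applied to the corresponding identity of the original one.
\<close>

lemma multiplicative_color_NHLP_algebra_yau_twist:
  assumes "color_NLP_endomorphism s V m b \<epsilon> \<beta>"
  shows "multiplicative_color_NHLP_algebra s V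
    (\<lambda>x y. \<beta> (m x y)) (\<lambda>x y. \<beta> (b x y)) \<epsilon> \<beta>"
proof -
  interpret \<beta>: color_NLP_morphism s V m b s V m b \<epsilon> \<beta> by (rule assms)
  interpret lin: Vector_Spaces.linear s s \<beta>
    using \<beta>.even_f by (simp add: even_linear_def)
  \<comment> \<open>Oriented to collect \<beta> on the outside. Additivity and homogeneity are
    included because the Leibniz and Poisson identities have a sum with an \<epsilon>-factor on the
    right, which \<beta> must cross.\<close>
  note hom = \<beta>.f_mu[symmetric] \<beta>.f_br[symmetric] lin.add[symmetric] lin.scale[symmetric]
  show ?thesis
  proof
    show "even_bilinear s V (\<lambda>x y. \<beta> (m x y))"
      by (rule even_bilinear_compose[OF \<beta>.A.even_mu \<beta>.even_f])
    show "even_bilinear s V (\<lambda>x y. \<beta> (b x y))"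
      by (rule even_bilinear_compose[OF \<beta>.A.even_br \<beta>.even_f])
    show "bicharacter \<epsilon>" by (rule \<beta>.A.bichar)
    show "even_linear s V s V \<beta>" by (rule \<beta>.even_f)
    fix x y z a d c assume "x \<in> V a" "y \<in> V d" "z \<in> V c"
    \<comment> \<open>The twisting map of the original algebra is \<open>id\<close>, so these are
      the untwisted identities.\<close>
    note leibniz = \<beta>.A.hom_leibniz[OF this] and assoc = \<beta>.A.hom_assoc[OF this]
      and poisson = \<beta>.A.hom_poisson[OF this]
    show "\<beta> (b (\<beta> x) (\<beta> (b y z))) =
        \<beta> (b (\<beta> (b x y)) (\<beta> z)) + s (\<epsilon> a d) (\<beta> (b (\<beta> y) (\<beta> (b x z))))"
      using leibniz by (simp add: hom)
    show "\<beta> (m (\<beta> x) (\<beta> (m y z))) = \<beta> (m (\<beta> (m x y)) (\<beta> z))"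
      using assoc by (simp add: hom)
    show "\<beta> (b (\<beta> x) (\<beta> (m y z))) =
        \<beta> (m (\<beta> (b x y)) (\<beta> z)) + s (\<epsilon> a d) (\<beta> (m (\<beta> y) (\<beta> (b x z))))"
      using poisson by (simp add: hom)
  \<comment> \<open>The multiplicativity goals remain. Here \<beta> is pushed inward instead, and
    both sides become the original operation applied to \<open>\<beta> (\<beta> x)\<close> and
    \<open>\<beta> (\<beta> y)\<close>.\<close>
  qed (simp_all add: \<beta>.f_mu \<beta>.f_br)
qed

lemma multiplicative_color_NHLP_algebra_twist:
  assumes "color_NLP_endomorphism s V m b \<epsilon> \<alpha>"
  shows "multiplicative_color_NHLP_algebra s V (twist \<alpha> n m) (twist \<alpha> n b) \<epsilon> (\<alpha> ^^ n)"
  using multiplicative_color_NHLP_algebra_yau_twist[OF color_NLP_endomorphism_funpow[OF assms]]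
  by (simp add: twist_def[abs_def])

text \<open>Each of the n factors can be moved past f in turn. The pointwise form serves both for
  commutation with the twisting maps and for moving f through a twisted product.\<close>

lemma funpow_intertwine:
  assumes "f \<circ> g = h \<circ> f"
  shows "f ((g ^^ n) x) = (h ^^ n) (f x)"
  using assms by (induction n) (simp_all add: fun_eq_iff)

lemma multiplicative_color_NHLP_morphism_twist:
  assumes "color_NLP_endomorphism s V m b \<epsilon> \<alpha>"
    and "color_NLP_endomorphism t W m' b' \<epsilon> \<alpha>'"
    and "color_NLP_morphism s V m b t W m' b' \<epsilon> f"
    and "f \<circ> \<alpha> = \<alpha>' \<circ> f"
  shows "multiplicative_color_NHLP_morphism
    s V (twist \<alpha> n m) (twist \<alpha> n b) (\<alpha> ^^ n)
    t W (twist \<alpha>' n m') (twist \<alpha>' n b') (\<alpha>' ^^ n) \<epsilon> f"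
proof -
  interpret f: color_NLP_morphism s V m b t W m' b' \<epsilon> f by (rule assms)
  show ?thesis
    \<comment> \<open>The map f and the gradings are unchanged, so evenness carries over. Three
      equations are left to the simplifier: for each operation, f passes
      \<open>\<alpha> ^^ n\<close> by intertwining and then the original product as a morphism; the
      third is the intertwining itself.\<close>
    by (intro multiplicative_color_NHLP_morphism.intro
          multiplicative_color_NHLP_morphism_axioms.intro
          multiplicative_color_NHLP_algebra_twist assms f.even_f)
      (simp_all add: twist_def fun_eq_iff funpow_intertwine[OF assms(4)] f.f_mu f.f_br)
qed

theorem theorem4p1:
  fixes scaleA :: "'k::field_char_0 \<Rightarrow> 'v::ab_group_add \<Rightarrow> 'v"
    and grA :: "'g::ab_group_add \<Rightarrow> 'v set"
    and \<mu> br :: "'v \<Rightarrow> 'v \<Rightarrow> 'v"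
    and \<epsilon> :: "'g \<Rightarrow> 'g \<Rightarrow> 'k"
    and \<alpha> :: "'v \<Rightarrow> 'v"
  assumes "color_NLP_algebra scaleA grA \<mu> br \<epsilon>"
    and "color_NLP_endomorphism scaleA grA \<mu> br \<epsilon> \<alpha>"
  shows "(\<forall>n\<ge>1. multiplicative_color_NHLP_algebra scaleA grA
            (twist \<alpha> n \<mu>) (twist \<alpha> n br) \<epsilon> (\<alpha> ^^ n)) \<and>
    (\<forall>(scaleB :: 'k \<Rightarrow> 'w::ab_group_add \<Rightarrow> 'w) (grB :: 'g \<Rightarrow> 'w set) \<mu>' br' \<alpha>' f.
       color_NLP_algebra scaleB grB \<mu>' br' \<epsilon> \<longrightarrow>
       color_NLP_endomorphism scaleB grB \<mu>' br' \<epsilon> \<alpha>' \<longrightarrow>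
       color_NLP_morphism scaleA grA \<mu> br scaleB grB \<mu>' br' \<epsilon> f \<longrightarrow>
       f \<circ> \<alpha> = \<alpha>' \<circ> f \<longrightarrow>
       (\<forall>n\<ge>1. multiplicative_color_NHLP_morphism
          scaleA grA (twist \<alpha> n \<mu>) (twist \<alpha> n br) (\<alpha> ^^ n)
          scaleB grB (twist \<alpha>' n \<mu>') (twist \<alpha>' n br') (\<alpha>' ^^ n) \<epsilon> f))"
  using assms(2)
  by (blast intro: multiplicative_color_NHLP_algebra_twist multiplicative_color_NHLP_morphism_twist)

end
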